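(* Let $q=q_1q_2\cdots q_k$ be an involution of length $k>2$ such that if $q_i=k$ then $i\leq k-2$. Let $C_n(q)$ be the number of cyclic permutations of length $n$ that avoid $q$. Then for all $n\geq 2$, $2C_n(q)\leq C_{n+1}(q)$.
   Context: A permutation of length $n$ is a linear order $p=p_1p_2\cdots p_n$ of $[n]=\{1,\dots,n\}$, also viewed as the bijection $i\mapsto p_i$. It is cyclic if, as a bijection of $[n]$, it consists of a single cycle of length $n$; it is an involution if its square is the identity. A permutation $p$ contains a pattern $q=q_1\cdots q_k$ if there are indices $i_1<\cdots<i_k$ such that for all $j,r$, $q_j<q_r$ iff $p_{i_j}<p_{i_r}$; otherwise $p$ avoids $q$. *)

theory Defs
  imports "HOL-Combinatorics.Combinatorics"
begin

text \<open>A permutation of length \<open>n\<close> is a function \<open>p\<close> with \<open>p permutes {1..n}\<close>;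
  its one-line notation is \<open>p 1, \<dots>, p n\<close>.\<close>

definition contains_pattern :: "nat \<Rightarrow> (nat \<Rightarrow> nat) \<Rightarrow> nat \<Rightarrow> (nat \<Rightarrow> nat) \<Rightarrow> bool" where
  "contains_pattern n p k q \<longleftrightarrow>
    (\<exists>f. f ` {1..k} \<subseteq> {1..n} \<and> strict_mono_on {1..k} f \<and>
      (\<forall>j\<in>{1..k}. \<forall>r\<in>{1..k}. q j < q r \<longleftrightarrow> p (f j) < p (f r)))"

definition avoids_pattern :: "nat \<Rightarrow> (nat \<Rightarrow> nat) \<Rightarrow> nat \<Rightarrow> (nat \<Rightarrow> nat) \<Rightarrow> bool" where
  "avoids_pattern n p k q \<longleftrightarrow> \<not> contains_pattern n p k q"

definition cyclic_avoiders :: "nat \<Rightarrow> nat \<Rightarrow> (nat \<Rightarrow> nat) \<Rightarrow> (nat \<Rightarrow> nat) set" where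
  "cyclic_avoiders n k q =
    {p. p permutes {1..n} \<and> cyclic_on p {1..n} \<and> avoids_pattern n p k q}"

definition num_cyclic_avoiders :: "nat \<Rightarrow> nat \<Rightarrow> (nat \<Rightarrow> nat) \<Rightarrow> nat" where
  "num_cyclic_avoiders n k q = card (cyclic_avoiders n k q)"

end

theory Submission
  imports Defs
begin

text \<open>Write \<open>\<tau>\<close> for the transposition of \<open>n\<close> and \<open>n + 1\<close>. If \<open>p\<close> is a cyclic permutation of
  \<open>{1..n}\<close>, then \<open>p \<circ> \<tau>\<close> and \<open>\<tau> \<circ> p\<close> arise by inserting \<open>n + 1\<close> into the cycle immediately
  after, respectively before, the element \<open>n\<close>. In one-line notation \<open>p \<circ> \<tau>\<close> inserts the new
  maximum just before the last entry, where it cannot play the role of the maximal entry of \<open>q\<close>,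
  which has at least two entries to its right. Hence \<open>p \<circ> \<tau>\<close> avoids \<open>q\<close> if \<open>p\<close> does, and
  \<open>\<tau> \<circ> p = (p\<^sup>-\<^sup>1 \<circ> \<tau>)\<^sup>-\<^sup>1\<close> does so as well, because \<open>q\<close> is an involution. The images of the two
  injections are disjoint: a common value would swap \<open>n\<close> and \<open>n + 1\<close>.\<close>

text \<open>Inversion reflects the graph of a permutation in the diagonal, exchanging positions and
  values, so an occurrence is carried to an occurrence of the reflected pattern.\<close>

lemma contains_pattern_inv:
  assumes p: "p permutes {1..n}" and q: "q permutes {1..k}"
    and "contains_pattern n p k q"
  shows "contains_pattern n (inv p) k (inv q)"
proof -
  obtain f where f: "f ` {1..k} \<subseteq> {1..n}" "strict_mono_on {1..k} f"
    and pq: "\<And>j r. j \<in> {1..k} \<Longrightarrow> r \<in> {1..k} \<Longrightarrow> q j < q r \<longleftrightarrow> p (f j) < p (f r)"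
    using assms(3) unfolding contains_pattern_def by blast
  have inv_q: "inv q j \<in> {1..k}" if "j \<in> {1..k}" for j
    using permutes_in_image[OF permutes_inv[OF q]] that by simp
  have f_less_iff: "f j < f r \<longleftrightarrow> j < r" if "j \<in> {1..k}" "r \<in> {1..k}" for j r
    using strict_mono_on_less[OF f(2)] that by simp
  \<comment> \<open>The values of \<open>p\<close> on the occurrence, listed in increasing order:
    \<open>f (inv q j)\<close> is the position of the \<open>j\<close>-th smallest. They serve as
    positions in \<open>inv p\<close>.\<close>
  let ?g = "p \<circ> f \<circ> inv q"
  have "?g ` {1..k} \<subseteq> {1..n}"
    using inv_q f(1) permutes_in_image[OF p] by (auto simp del: atLeastAtMost_iff)
  moreover have "strict_mono_on {1..k} ?g"
  proof (rule strict_mono_onI)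
    fix r s assume rs: "r \<in> {1..k}" "s \<in> {1..k}" "r < s"
    thus "?g r < ?g s"
      using pq[OF inv_q[OF rs(1)] inv_q[OF rs(2)]] by (simp add: permutes_inverses[OF q])
  qed
  moreover have "inv q j < inv q r \<longleftrightarrow> inv p (?g j) < inv p (?g r)"
    if "j \<in> {1..k}" "r \<in> {1..k}" for j r
    using f_less_iff[OF inv_q[OF that(1)] inv_q[OF that(2)]] by (simp add: permutes_inverses[OF p])
  ultimately show ?thesis unfolding contains_pattern_def by blast
qed

text \<open>Deleting the entry \<open>n + 1\<close>, which stands at position \<open>n\<close>,
  leaves the one-line notation of \<open>p\<close>. So it is enough that no occurrence of
  \<open>q\<close> uses this position.\<close>

lemma contains_pattern_comp_transpose:
  assumes p: "p permutes {1..n}" and q: "q permutes {1..k}"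
    and pos: "\<forall>i\<in>{1..k}. q i = k \<longrightarrow> i \<le> k - 2" and "k > 2"
    and "contains_pattern (n + 1) (p \<circ> transpose n (n + 1)) k q"
  shows "contains_pattern n p k q"
proof -
  let ?t = "transpose n (n + 1)"
  obtain f where f: "f ` {1..k} \<subseteq> {1..n + 1}" "strict_mono_on {1..k} f"
    and pq: "\<And>j r. j \<in> {1..k} \<Longrightarrow> r \<in> {1..k} \<Longrightarrow> q j < q r \<longleftrightarrow> p (?t (f j)) < p (?t (f r))"
    using assms(5) unfolding contains_pattern_def by auto
  have f_in: "f j \<in> {1..n + 1}" if "j \<in> {1..k}" for j
    using f(1) that by blast
  have p_top: "p (n + 1) = n + 1"
    using p by (auto simp: permutes_def)
  \<comment> \<open>An occurrence using the position of the maximum must use it for the entry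
    \<open>k\<close> of \<open>q\<close>. Two further positions would then lie to the right of
    \<open>n\<close>, but only \<open>n + 1\<close> does.\<close>
  have not_n: "f j \<noteq> n" if j: "j \<in> {1..k}" for j
  proof
    assume fj: "f j = n"
    have "n \<ge> 1" using f_in[OF j] fj by simp
    hence le_top: "p (?t x) \<le> n + 1" if "x \<in> {1..n + 1}" for x
      using permutes_in_image[OF permutes_subset[OF p, of "{1..n + 1}"], of "?t x"] that
      by (auto simp: transpose_def)
    have "\<not> q j < q r" if r: "r \<in> {1..k}" for r
      using le_top[OF f_in[OF r]] pq[OF j r] fj p_top by simp
    moreover have "q (inv q k) = k" "inv q k \<in> {1..k}"
      using permutes_inverses[OF q] permutes_in_image[OF permutes_inv[OF q], of k] \<open>k > 2\<close> by auto
    moreover have "q j \<le> k"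
      using permutes_in_image[OF q, of j] j by auto
    ultimately have "q j = k"
      by (metis le_antisym not_less)
    hence "j \<le> k - 2" using pos j by blast
    hence in_dom: "j + 1 \<in> {1..k}" "j + 2 \<in> {1..k}"
      using \<open>k > 2\<close> by auto
    hence "f j < f (j + 1)" "f (j + 1) < f (j + 2)"
      using j by (auto intro!: strict_mono_onD[OF f(2)])
    thus False using f_in[OF in_dom(2)] fj by simp
  qed
  \<comment> \<open>As \<open>f\<close> misses \<open>n\<close>, on its range \<open>?t\<close> only
    moves \<open>n + 1\<close> down to \<open>n\<close>. Hence \<open>?t \<circ> f\<close> stays
    increasing, and \<open>pq\<close> already describes the values of \<open>p\<close> along
    it.\<close>
  have "(?t \<circ> f) ` {1..k} \<subseteq> {1..n}"
  proof (rule image_subsetI)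
    fix i assume i: "i \<in> {1..k}"
    have "f 1 < f 2"
      using \<open>k > 2\<close> by (intro strict_mono_onD[OF f(2)]) auto
    hence "n \<ge> 1"
      using f_in[of 1] f_in[of 2] \<open>k > 2\<close> by simp
    thus "(?t \<circ> f) i \<in> {1..n}"
      using f_in[OF i] not_n[OF i] by (auto simp: transpose_def)
  qed
  moreover have "strict_mono_on {1..k} (?t \<circ> f)"
  proof (rule strict_mono_onI)
    fix r s assume rs: "r \<in> {1..k}" "s \<in> {1..k}" "r < s"
    have "f r < f s" using strict_mono_onD[OF f(2)] rs by blast
    thus "(?t \<circ> f) r < (?t \<circ> f) s"
      using f_in[OF rs(2)] not_n[OF rs(1)] not_n[OF rs(2)] by (auto simp: transpose_def)
  qed
  ultimately show ?thesis
    unfolding contains_pattern_def using pq by (intro exI[of _ "?t \<circ> f"]) auto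
qed

lemma permutes_comp_transpose:
  fixes n :: nat
  assumes "p permutes {1..n}" and "n \<ge> 1"
  shows "p \<circ> transpose n (n + 1) permutes {1..n + 1}"
  using assms
  by (intro permutes_compose permutes_swap_id permutes_subset[OF assms(1)]) auto

text \<open>The step from \<open>n\<close> to \<open>p n\<close> becomes the detour from
  \<open>n\<close> over \<open>n + 1\<close> to \<open>p n\<close>; the rest of the cycle is
  unchanged.\<close>

lemma cyclic_on_comp_transpose:
  fixes n :: nat
  assumes p: "p permutes {1..n}" and cyc: "cyclic_on p {1..n}" and n: "n \<ge> 1"
  shows "cyclic_on (p \<circ> transpose n (n + 1)) {1..n + 1}"
proof -
  let ?f = "p \<circ> transpose n (n + 1)"
  have p_top: "p (n + 1) = n + 1"
    using p by (auto simp: permutes_def)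
  have f_n: "?f n = n + 1" and f_top: "?f (n + 1) = p n"
    using p_top by auto
  have orb: "orbit p n = {1..n}"
    using cyc n by (auto simp: cyclic_on_alldef)
  have top: "n + 1 \<in> orbit ?f n"
    using orbit.base[of ?f n] f_n by simp
  have pn: "p n \<in> orbit ?f n"
    using orbit.step[OF top] f_top by simp
  \<comment> \<open>Follow the cycle of \<open>p\<close> from \<open>n\<close>: within
    \<open>{1..n}\<close> the two maps differ only at \<open>n\<close>, whose image
    \<open>p n\<close> is reached through the detour.\<close>
  have "y \<in> orbit ?f n" if "y \<in> orbit p n" for y
    using that
  proof (induction rule: orbit.induct)
    case base
    show ?case by (rule pn)
  next
    case (step y)
    show ?case
    proof (cases "y = n")
      case False
      moreover have "y \<noteq> n + 1" using step.hyps orb by auto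
      ultimately have "?f y = p y" by (simp add: transpose_def)
      thus ?thesis using orbit.step[OF step.IH] by simp
    qed (use pn in \<open>simp add: comp_def\<close>)
  qed
  with orb top have "{1..n + 1} \<subseteq> orbit ?f n"
    by (auto simp: le_Suc_eq)
  moreover have "orbit ?f n \<subseteq> {1..n + 1}"
    using permutes_orbit_subset[OF permutes_comp_transpose[OF p n]] n by simp
  ultimately show ?thesis
    using n by (intro cyclic_on_singleI[of n]) auto
qed

lemma cyclic_on_inv:
  assumes "p permutes S" and "cyclic_on p S" and "finite S"
  shows "cyclic_on (inv p) S"
  using assms orbit_inv_eq[OF permutes_imp_permutation[OF assms(3,1)]]
  by (simp add: cyclic_on_def)

text \<open>An occurrence of \<open>q\<close> in \<open>inv p\<close> yields one of
  \<open>inv q\<close> in \<open>p\<close>, and \<open>inv q = q\<close> for an involution.\<close>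

lemma inv_mem_cyclic_avoiders:
  assumes "p \<in> cyclic_avoiders n k q" and q: "q permutes {1..k}" and "q \<circ> q = id"
  shows "inv p \<in> cyclic_avoiders n k q"
proof -
  have p: "p permutes {1..n}" "cyclic_on p {1..n}" "\<not> contains_pattern n p k q"
    using assms(1) by (auto simp: cyclic_avoiders_def avoids_pattern_def)
  have "inv q = q"
    using assms(3) by (simp add: inv_unique_comp)
  hence "\<not> contains_pattern n (inv p) k q"
    using contains_pattern_inv[OF permutes_inv[OF p(1)] q] p by (auto simp: permutes_inv_inv)
  thus ?thesis
    using p by (auto simp: cyclic_avoiders_def avoids_pattern_def permutes_inv cyclic_on_inv)
qed

lemma comp_transpose_mem_cyclic_avoiders:
  assumes "p \<in> cyclic_avoiders n k q" and "q permutes {1..k}"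
    and "\<forall>i\<in>{1..k}. q i = k \<longrightarrow> i \<le> k - 2" and "k > 2" and "n \<ge> 1"
  shows "p \<circ> transpose n (n + 1) \<in> cyclic_avoiders (n + 1) k q"
  using assms contains_pattern_comp_transpose[OF _ assms(2-4)]
    permutes_comp_transpose cyclic_on_comp_transpose
  unfolding cyclic_avoiders_def avoids_pattern_def by blast

theorem theorem23:
  fixes k n :: nat and q :: "nat \<Rightarrow> nat"
  assumes "k > 2"
    and "q permutes {1..k}"
    and "q \<circ> q = id"
    and "\<forall>i\<in>{1..k}. q i = k \<longrightarrow> i \<le> k - 2"
    and "n \<ge> 2"
  shows "2 * num_cyclic_avoiders n k q \<le> num_cyclic_avoiders (n + 1) k q"
proof -
  let ?t = "transpose n (n + 1)"
  let ?A = "cyclic_avoiders n k q" and ?B = "cyclic_avoiders (n + 1) k q"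
  let ?R = "(\<lambda>p. p \<circ> ?t) ` ?A" and ?L = "(\<lambda>p. ?t \<circ> p) ` ?A"
  have R: "?R \<subseteq> ?B"
    using comp_transpose_mem_cyclic_avoiders assms by auto
  have L: "?L \<subseteq> ?B"
  proof (rule image_subsetI)
    fix p assume p: "p \<in> ?A"
    hence "bij p"
      by (auto simp: cyclic_avoiders_def permutes_bij)
    hence "inv (inv p \<circ> ?t) = ?t \<circ> p"
      by (simp add: o_inv_distrib bij_imp_bij_inv inv_inv_eq)
    moreover have "inv (inv p \<circ> ?t) \<in> ?B"
      using p assms by (intro inv_mem_cyclic_avoiders comp_transpose_mem_cyclic_avoiders) auto
    ultimately show "?t \<circ> p \<in> ?B" by simp
  qed
  have "inj_on (\<lambda>p. p \<circ> ?t) ?A"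
    by (rule inj_on_inverseI[where g = "\<lambda>p. p \<circ> ?t"]) (simp add: comp_assoc)
  hence card_R: "card ?R = card ?A" by (rule card_image)
  have "inj_on (\<lambda>p. ?t \<circ> p) ?A"
    by (rule inj_on_inverseI[where g = "\<lambda>p. ?t \<circ> p"]) (simp flip: comp_assoc)
  hence card_L: "card ?L = card ?A" by (rule card_image)
  have disj: "?R \<inter> ?L = {}"
  proof (rule ccontr)
    assume "?R \<inter> ?L \<noteq> {}"
    then obtain r p p' where r: "r \<in> ?B" "r = p \<circ> ?t" "r = ?t \<circ> p'" and "p \<in> ?A" "p' \<in> ?A"
      using R by blast
    hence "p (n + 1) = n + 1" "p' (n + 1) = n + 1"
      by (auto simp: cyclic_avoiders_def permutes_def)
    \<comment> \<open>The first value is read off from \<open>p \<circ> ?t\<close>, the second from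
      \<open>?t \<circ> p'\<close>.\<close>
    hence "r n = n + 1" "r (n + 1) = n"
      using r(2) fun_cong[OF r(3), of "n + 1"] by auto
    note swap = this
    have "y \<in> {n, n + 1}" if "y \<in> orbit r n" for y
      using that by (induction rule: orbit.induct) (use swap in auto)
    moreover have "orbit r n = {1..n + 1}"
      using r(1) assms(5) by (auto simp: cyclic_avoiders_def cyclic_on_alldef)
    \<comment> \<open>Since \<open>n \<ge> 2\<close>, the point 1 lies outside the 2-cycle of
      \<open>n\<close> and \<open>n + 1\<close>.\<close>
    moreover have "1 \<in> {1..n + 1}" by simp
    ultimately have "1 \<in> {n, n + 1}" by blast
    thus False using assms(5) by simp
  qed
  have fin: "finite ?B"
    by (rule finite_subset[OF _ finite_permutations[of "{1..n + 1}"]])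
      (auto simp: cyclic_avoiders_def)
  have "2 * card ?A = card (?R \<union> ?L)"
    using card_R card_L disj fin R L by (subst card_Un_disjoint) (auto dest: finite_subset)
  also have "\<dots> \<le> card ?B"
    using R L fin by (intro card_mono) auto
  finally show ?thesis by (simp add: num_cyclic_avoiders_def)
qed

end
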